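(* For each $n\geq2$ and $\lambda>0$, one has $$ b_{1,n}(\lambda)=\sum_{k=2}^{n}b_{1,n-k}(\lambda)\, M_{k-2}(\lambda), $$ where $$ M_m(\lambda):=\sum_{\varepsilon\in\mathcal{M}(m)}\lambda^{|\varepsilon|_0}, \qquad M_0(\lambda)=1, $$ $\mathcal{M}(m)$ is the set of Motzkin paths of length $m$, $|\varepsilon|_0$ is the number of level-steps of $\varepsilon$, and $b_{1,n}(\lambda)=\langle (A_1+A_1^{\dagger}+\lambda A_1^{\dagger}A_1)^n\Omega,\Omega\rangle$ is the $n$-th vacuum moment.
   Context: Let $\mathcal{H}$ be a separable Hilbert space with a fixed orthonormal basis $(e_i)_{i\ge1}$. The weakly monotone Fock space is the closed subspace of the full Fock space on $\mathcal{H}$ (with vacuum vector $\Omega=1\oplus 0\oplus\cdots$) spanned by $\Omega$, $\mathcal{H}$ and all simple tensors $e_{i_k}\otimes e_{i_{k-1}}\otimes\cdots\otimes e_{i_1}$ with $i_k\ge i_{k-1}\ge\cdots\ge i_1$, $k\ge2$. For $i\geq 1$, the annihilation operator $A_i$ and the creation operator $A_i^{\dagger}$ are the mutually adjoint bounded operators on it determined by: $A_i\Omega=0$, $A_i e_j=\delta_{i,j}\Omega$, $A_i(e_{i_k}\otimes e_{i_{k-1}}\otimes\cdots\otimes e_{i_1})=\delta_{i,i_k}\,e_{i_{k-1}}\otimes\cdots\otimes e_{i_1}$; $A_i^{\dagger}\Omega=e_i$, $A_i^{\dagger}(e_{i_k}\otimes\cdots\otimes e_{i_1})=e_i\otimes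 e_{i_k}\otimes\cdots\otimes e_{i_1}$ if $i\ge i_k$ and $0$ otherwise ($k\ge1$). A Motzkin path of length $m$ is a lattice path in $\mathbb{Z}\times\mathbb{Z}$ from $(0,0)$ to $(m,0)$ with up-steps $(1,1)$, down-steps $(1,-1)$ and level-steps $(1,0)$, never passing below the $x$-axis. *)

theory Defs
  imports "HOL-Analysis.Analysis"
begin

section \<open>Complex Hilbert spaces\<close>

text \<open>
  The library only has real inner product spaces, so a complex Hilbert space is a complete real
  one with a compatible complex structure: the real inner product, and hence the norm and the
  topology, are those induced by the complex inner product \<open>cinner\<close>, which is linear in its first
  and conjugate-linear in its second argument.
\<close>

class complex_hilbert_space = real_inner + complete_space +
  fixes cscale :: "complex \<Rightarrow> 'a \<Rightarrow> 'a" (infixr "*\<^sub>C" 75)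
    and cinner :: "'a \<Rightarrow> 'a \<Rightarrow> complex"
  assumes cscale_add_right: "c *\<^sub>C (x + y) = c *\<^sub>C x + c *\<^sub>C y"
    and cscale_add_left: "(c + d) *\<^sub>C x = c *\<^sub>C x + d *\<^sub>C x"
    and cscale_cscale: "c *\<^sub>C d *\<^sub>C x = (c * d) *\<^sub>C x"
    and scaleR_eq_cscale: "r *\<^sub>R x = complex_of_real r *\<^sub>C x"
    and cinner_commute: "cinner x y = cnj (cinner y x)"
    and cinner_add_left: "cinner (x + y) z = cinner x z + cinner y z"
    and cinner_cscale_left: "cinner (c *\<^sub>C x) y = c * cinner x y"
    and inner_eq_Re_cinner: "inner x y = Re (cinner x y)"

instantiation complex :: complex_hilbert_space
begin

definition cscale_complex :: "complex \<Rightarrow> complex \<Rightarrow> complex" where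
  "cscale_complex c x = c * x"

definition cinner_complex :: "complex \<Rightarrow> complex \<Rightarrow> complex" where
  "cinner_complex x y = x * cnj y"

instance
  by standard
    (auto simp: cscale_complex_def cinner_complex_def algebra_simps scaleR_conv_of_real
      inner_complex_def)

end

lemma vector_space_cscale:
  "vector_space (cscale :: complex \<Rightarrow> 'a \<Rightarrow> 'a::complex_hilbert_space)"
proof
  show "1 *\<^sub>C x = x" for x :: 'a
    using scaleR_eq_cscale[of 1 x] by simp
qed (simp_all add: cscale_add_right cscale_add_left cscale_cscale)

definition closed_cspan :: "'a::complex_hilbert_space set \<Rightarrow> 'a set" where
  "closed_cspan S = closure (module.span cscale S)"

text \<open>Orthonormal bases \<open>(e\<^sub>i)\<close> are indexed by \<open>i \<ge> 1\<close>; the value \<open>e 0\<close> plays no role.\<close>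

definition orthonormal_basis :: "(nat \<Rightarrow> 'h::complex_hilbert_space) \<Rightarrow> bool" where
  "orthonormal_basis e \<longleftrightarrow>
     (\<forall>i\<ge>1. \<forall>j\<ge>1. cinner (e i) (e j) = (if i = j then 1 else 0)) \<and>
     closed_cspan (e ` {1..}) = UNIV"

text \<open>\<open>T\<close> only matters on the subspace \<open>W\<close>.\<close>

definition bounded_operator_on ::
  "'a::complex_hilbert_space set \<Rightarrow> ('a \<Rightarrow> 'a) \<Rightarrow> bool" where
  "bounded_operator_on W T \<longleftrightarrow>
     (\<forall>x\<in>W. T x \<in> W) \<and>
     (\<forall>x\<in>W. \<forall>y\<in>W. T (x + y) = T x + T y) \<and>
     (\<forall>c. \<forall>x\<in>W. T (c *\<^sub>C x) = c *\<^sub>C T x) \<and>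
     (\<exists>K. \<forall>x\<in>W. norm (T x) \<le> K * norm x)"


section \<open>Fock spaces\<close>

text \<open>
  The type \<open>'f\<close> is (a model of) the full Fock space
  \<open>\<complex>\<Omega> \<oplus> \<H> \<oplus> (\<H> \<otimes> \<H>) \<oplus> \<dots>\<close> over \<open>\<H> = 'h\<close>: the Hilbert space completion of the linear
  span of the simple tensors \<open>tens [h\<^sub>1, \<dots>, h\<^sub>k] = h\<^sub>1 \<otimes> \<dots> \<otimes> h\<^sub>k\<close>, with the usual inner
  product. These data determine \<open>('f, tens)\<close> up to a unique unitary isomorphism, and they imply
  that \<open>tens\<close> is linear in every entry. The vacuum \<open>1 \<oplus> 0 \<oplus> \<dots>\<close> is the empty tensor.
\<close>

definition full_fock_space ::
  "('h::complex_hilbert_space list \<Rightarrow> 'f::complex_hilbert_space) \<Rightarrow> bool" where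
  "full_fock_space tens \<longleftrightarrow>
     (\<forall>xs ys. cinner (tens xs) (tens ys) =
        (if length xs = length ys then prod_list (map2 cinner xs ys) else 0)) \<and>
     closed_cspan (range tens) = UNIV"

abbreviation vacuum :: "('h list \<Rightarrow> 'f) \<Rightarrow> 'f" where
  "vacuum tens \<equiv> tens []"

text \<open>
  The word \<open>[i\<^sub>k, i\<^sub>k\<^sub>-\<^sub>1, \<dots>, i\<^sub>1]\<close>, in this order, stands for
  \<open>e\<^bsub>i\<^sub>k\<^esub> \<otimes> \<dots> \<otimes> e\<^bsub>i\<^sub>1\<^esub>\<close>.
\<close>

definition monotone_word :: "nat list \<Rightarrow> bool" where
  "monotone_word w \<longleftrightarrow> (\<forall>i\<in>set w. 1 \<le> i) \<and> sorted_wrt (\<ge>) w"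

definition basis_tensor ::
  "('h list \<Rightarrow> 'f) \<Rightarrow> (nat \<Rightarrow> 'h) \<Rightarrow> nat list \<Rightarrow> 'f" where
  "basis_tensor tens e w = tens (map e w)"

definition weakly_monotone_fock_space ::
  "('h::complex_hilbert_space list \<Rightarrow> 'f::complex_hilbert_space) \<Rightarrow> (nat \<Rightarrow> 'h) \<Rightarrow> 'f set" where
  "weakly_monotone_fock_space tens e =
     closed_cspan ({vacuum tens} \<union> range (\<lambda>h. tens [h]) \<union>
       {basis_tensor tens e w |w. monotone_word w \<and> length w \<ge> 2})"

text \<open>
  \<open>A i\<close> and \<open>Ad i\<close> are the annihilation and creation operators of index \<open>i\<close>. They are linear,
  bounded, and prescribed on a total set, hence determined on the weakly monotone Fock space by
  the conditions below. The word \<open>j # w\<close> has \<open>j = i\<^sub>k\<close>; the case \<open>w = []\<close> is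
  \<open>A\<^sub>i e\<^sub>j = \<delta>\<^sub>i\<^sub>j \<Omega>\<close>.
\<close>

locale weakly_monotone_fock =
  fixes tens :: "'h::complex_hilbert_space list \<Rightarrow> 'f::complex_hilbert_space"
    and e :: "nat \<Rightarrow> 'h"
    and A Ad :: "nat \<Rightarrow> 'f \<Rightarrow> 'f"
  assumes full_fock_space: "full_fock_space tens"
    and orthonormal_basis: "orthonormal_basis e"
    and bounded_annihilation:
      "1 \<le> i \<Longrightarrow> bounded_operator_on (weakly_monotone_fock_space tens e) (A i)"
    and bounded_creation:
      "1 \<le> i \<Longrightarrow> bounded_operator_on (weakly_monotone_fock_space tens e) (Ad i)"
    and mutually_adjoint:
      "\<lbrakk>1 \<le> i; x \<in> weakly_monotone_fock_space tens e; y \<in> weakly_monotone_fock_space tens e\<rbrakk>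
        \<Longrightarrow> cinner (A i x) y = cinner x (Ad i y)"
    and annihilation_vacuum: "1 \<le> i \<Longrightarrow> A i (vacuum tens) = 0"
    and annihilation_tensor:
      "\<lbrakk>1 \<le> i; monotone_word (j # w)\<rbrakk> \<Longrightarrow>
        A i (basis_tensor tens e (j # w)) = (if i = j then basis_tensor tens e w else 0)"
    and creation_vacuum: "1 \<le> i \<Longrightarrow> Ad i (vacuum tens) = basis_tensor tens e [i]"
    and creation_tensor:
      "\<lbrakk>1 \<le> i; monotone_word (j # w)\<rbrakk> \<Longrightarrow>
        Ad i (basis_tensor tens e (j # w)) =
          (if j \<le> i then basis_tensor tens e (i # j # w) else 0)"

definition vacuum_moment ::
  "('h list \<Rightarrow> 'f::complex_hilbert_space) \<Rightarrow> (nat \<Rightarrow> 'f \<Rightarrow> 'f) \<Rightarrow> (nat \<Rightarrow> 'f \<Rightarrow> 'f) \<Rightarrow>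
    nat \<Rightarrow> real \<Rightarrow> complex" where
  "vacuum_moment tens A Ad n lam =
     cinner (((\<lambda>x. A 1 x + Ad 1 x + complex_of_real lam *\<^sub>C Ad 1 (A 1 x)) ^^ n) (vacuum tens))
       (vacuum tens)"


section \<open>Motzkin paths\<close>

text \<open>
  A path starting at \<open>(0,0)\<close> is given by the list of the vertical components of its steps:
  \<open>1\<close>, \<open>-1\<close> and \<open>0\<close> for the up-step \<open>(1,1)\<close>, the down-step \<open>(1,-1)\<close> and the level-step \<open>(1,0)\<close>.
  After \<open>j\<close> steps it is at the point \<open>(j, sum_list (take j \<epsilon>))\<close>.
\<close>

definition motzkin_paths :: "nat \<Rightarrow> int list set" where
  "motzkin_paths m =
     {\<epsilon>. length \<epsilon> = m \<and> set \<epsilon> \<subseteq> {1, -1, 0} \<and>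
         (\<forall>j\<le>m. 0 \<le> sum_list (take j \<epsilon>)) \<and> sum_list \<epsilon> = 0}"

definition motzkin_poly :: "nat \<Rightarrow> real \<Rightarrow> real" where
  "motzkin_poly m lam = (\<Sum>\<epsilon>\<in>motzkin_paths m. lam ^ count_list \<epsilon> 0)"

lemma finite_motzkin_paths: "finite (motzkin_paths m)"
  by (rule finite_subset[OF _ finite_lists_length_eq[of "{1, -1, 0::int}" m]])
    (auto simp: motzkin_paths_def)

lemma motzkin_poly_0: "motzkin_poly 0 lam = 1"
proof -
  have "motzkin_paths 0 = {[]}"
    by (auto simp: motzkin_paths_def)
  then show ?thesis
    by (simp add: motzkin_poly_def)
qed

end

theory Submission
  imports Defs
begin

text \<open>
  Write \<open>v\<^sub>k = e\<^sub>1 \<otimes> \<dots> \<otimes> e\<^sub>1\<close> (\<open>k\<close> factors, \<open>v\<^sub>0 = \<Omega>\<close>) and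
  \<open>T = A\<^sub>1 + A\<^sub>1\<^sup>\<dagger> + \<lambda> A\<^sub>1\<^sup>\<dagger> A\<^sub>1\<close>. On these vectors \<open>T\<close> is a Jacobi matrix:
  \<open>T v\<^sub>0 = v\<^sub>1\<close> and \<open>T v\<^sub>k\<^sub>+\<^sub>1 = v\<^sub>k + \<lambda> v\<^sub>k\<^sub>+\<^sub>1 + v\<^sub>k\<^sub>+\<^sub>2\<close>. So \<open>\<langle>T\<^sup>n \<Omega>, v\<^sub>k\<rangle>\<close> counts the
  nonnegative paths with \<open>n\<close> steps from height \<open>0\<close> to height \<open>k\<close>, with weight \<open>\<lambda>\<close> for each
  level step, except that level steps at height \<open>0\<close> are forbidden.

  Cut such a path to height \<open>k + 1\<close> after its last visit to height \<open>0\<close>, at time \<open>j\<close>. What comes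
  before contributes the moment \<open>b\<^sub>j\<close>; then there is an up-step; what remains is a path of length
  \<open>n - 1 - j\<close> from height \<open>1\<close> to height \<open>k + 1\<close> that stays at height at least \<open>1\<close>, and on which
  level steps are therefore unrestricted: a translated prefix of a Motzkin path
  (\<open>last_visit_decomposition\<close>). A path that counts for \<open>b\<^sub>n\<close>, \<open>n \<ge> 1\<close>, ends with a step from
  height \<open>1\<close> to height \<open>0\<close>, so \<open>b\<^sub>n = \<langle>T\<^bsup>n-1\<^esup> \<Omega>, v\<^sub>1\<rangle>\<close>, and the case \<open>k = 0\<close> of the decomposition
  is the claimed recursion.

  The two sides are compared through their recursions in the number of steps only. For the
  operator, symmetry moves one factor \<open>T\<close> onto \<open>v\<^sub>k\<close>, so that the powers \<open>T\<^sup>n \<Omega>\<close> need not be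
  expanded.
\<close>

section \<open>Prefixes of Motzkin paths\<close>

text \<open>
  The recursion by the last step involves the paths that end at height \<open>h - 1\<close>. With integer
  heights it also covers \<open>h = 0\<close>, because no path ends below \<open>0\<close>.
\<close>

definition motzkin_prefixes :: "nat \<Rightarrow> int \<Rightarrow> int list set" where
  "motzkin_prefixes m h =
     {p. length p = m \<and> set p \<subseteq> {1, -1, 0} \<and>
         (\<forall>j\<le>m. 0 \<le> sum_list (take j p)) \<and> sum_list p = h}"

definition motzkin_prefix_poly :: "nat \<Rightarrow> int \<Rightarrow> real \<Rightarrow> real" where
  "motzkin_prefix_poly m h lam = (\<Sum>p\<in>motzkin_prefixes m h. lam ^ count_list p 0)"

lemma motzkin_poly_eq_prefix_poly: "motzkin_poly m lam = motzkin_prefix_poly m 0 lam"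
  by (simp add: motzkin_poly_def motzkin_prefix_poly_def motzkin_paths_def motzkin_prefixes_def)

lemma finite_motzkin_prefixes: "finite (motzkin_prefixes m h)"
  by (rule finite_subset[OF _ finite_lists_length_eq[of "{1, -1, 0::int}" m]])
    (auto simp: motzkin_prefixes_def)

lemma motzkin_prefix_poly_0: "motzkin_prefix_poly 0 h lam = (if h = 0 then 1 else 0)"
proof -
  have "motzkin_prefixes 0 h = (if h = 0 then {[]} else {})"
    by (auto simp: motzkin_prefixes_def)
  then show ?thesis
    by (simp add: motzkin_prefix_poly_def)
qed

lemma motzkin_prefix_poly_neg:
  assumes "h < 0"
  shows "motzkin_prefix_poly m h lam = 0"
proof -
  have "motzkin_prefixes m h = {}"
    using assms by (auto simp: motzkin_prefixes_def)
  then show ?thesis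
    by (simp add: motzkin_prefix_poly_def)
qed

lemma snoc_in_motzkin_prefixes_iff:
  "p @ [s] \<in> motzkin_prefixes (Suc m) h \<longleftrightarrow>
     0 \<le> h \<and> s \<in> {1, -1, 0} \<and> p \<in> motzkin_prefixes m (h - s)"
  by (auto simp: motzkin_prefixes_def le_Suc_eq all_conj_distrib)

lemma motzkin_prefixes_Suc:
  assumes "0 \<le> h"
  shows "motzkin_prefixes (Suc m) h =
    (\<Union>s\<in>{1, -1, 0}. (\<lambda>p. p @ [s]) ` motzkin_prefixes m (h - s))"
    (is "?L = ?R")
proof (rule set_eqI)
  fix q
  show "q \<in> ?L \<longleftrightarrow> q \<in> ?R"
  proof (cases q rule: rev_cases)
    case Nil
    then show ?thesis by (auto simp: motzkin_prefixes_def)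
  next
    case (snoc p s)
    then show ?thesis
      using assms by (auto simp: snoc_in_motzkin_prefixes_iff)
  qed
qed

lemma motzkin_prefix_poly_Suc:
  assumes "0 \<le> h"
  shows "motzkin_prefix_poly (Suc m) h lam =
    motzkin_prefix_poly m (h - 1) lam + lam * motzkin_prefix_poly m h lam
    + motzkin_prefix_poly m (h + 1) lam"
proof -
  have "motzkin_prefix_poly (Suc m) h lam =
      (\<Sum>s\<in>{1, -1, 0}. \<Sum>q\<in>(\<lambda>p. p @ [s]) ` motzkin_prefixes m (h - s). lam ^ count_list q 0)"
    unfolding motzkin_prefix_poly_def motzkin_prefixes_Suc[OF assms]
    by (rule sum.UNION_disjoint) (auto simp: finite_motzkin_prefixes)
  also have "\<dots> = (\<Sum>s\<in>{1, -1, 0}. \<Sum>p\<in>motzkin_prefixes m (h - s). lam ^ count_list (p @ [s]) 0)"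
    by (intro sum.cong[OF refl]) (simp add: sum.reindex inj_on_def)
  finally show ?thesis
    by (simp add: motzkin_prefix_poly_def sum_distrib_left)
qed

text \<open>
  The case to keep in mind: \<open>c n k\<close> is the weight of the nonnegative paths with \<open>n\<close> steps to
  height \<open>k\<close> whose level steps at height \<open>0\<close> are forbidden. As functions of \<open>(n, k)\<close>, both
  sides obey the same recursion: a level step at height \<open>1\<close> becomes a level step at height \<open>0\<close>
  of the translated prefix. The term \<open>c n 0\<close>, which enters the recursion at \<open>k = 0\<close> only, is
  the new summand \<open>j = n\<close>.
\<close>

lemma last_visit_decomposition:
  fixes c :: "nat \<Rightarrow> nat \<Rightarrow> complex"
  assumes start: "\<And>k. c 0 (Suc k) = 0"
    and step: "\<And>n k. c (Suc n) (Suc k) =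
      c n k + complex_of_real lam * c n (Suc k) + c n (Suc (Suc k))"
  shows "c n (Suc k) =
    (\<Sum>j<n. c j 0 * complex_of_real (motzkin_prefix_poly (n - Suc j) (int k) lam))"
proof (induction n arbitrary: k)
  case 0
  then show ?case by (simp add: start)
next
  case (Suc n)
  let ?P = "\<lambda>m h. complex_of_real (motzkin_prefix_poly m h lam)"
  have prefix_step: "?P (n - j) (int k) =
      ?P (n - Suc j) (int k - 1) + complex_of_real lam * ?P (n - Suc j) (int k)
      + ?P (n - Suc j) (int k + 1)" if "j < n" for j
  proof -
    have "n - j = Suc (n - Suc j)"
      using that by simp
    then show ?thesis
      by (simp add: motzkin_prefix_poly_Suc)
  qed
  have down: "c n k = c n 0 * ?P 0 (int k) + (\<Sum>j<n. c j 0 * ?P (n - Suc j) (int k - 1))"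
  proof (cases k)
    case 0
    then show ?thesis
      by (simp add: motzkin_prefix_poly_0 motzkin_prefix_poly_neg)
  next
    case (Suc k')
    then show ?thesis
      by (simp add: motzkin_prefix_poly_0 Suc.IH)
  qed
  have up: "c n (Suc (Suc k)) = (\<Sum>j<n. c j 0 * ?P (n - Suc j) (int k + 1))"
    using Suc.IH[of "Suc k"] by (simp add: add.commute)
  have "c (Suc n) (Suc k) = c n 0 * ?P 0 (int k) +
      (\<Sum>j<n. c j 0 * (?P (n - Suc j) (int k - 1) + complex_of_real lam * ?P (n - Suc j) (int k)
        + ?P (n - Suc j) (int k + 1)))"
    unfolding step down up Suc.IH[of k]
    by (simp add: sum.distrib sum_distrib_left algebra_simps)
  also have "\<dots> = c n 0 * ?P 0 (int k) + (\<Sum>j<n. c j 0 * ?P (n - j) (int k))"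
    by (simp add: prefix_step)
  finally show ?case
    by simp
qed

section \<open>The operator on the powers of the first basis vector\<close>

lemma cinner_add_right: "cinner x (y + z) = cinner x y + cinner x z"
  by (metis cinner_add_left cinner_commute complex_cnj_add)

lemma cinner_cscale_right: "cinner x (c *\<^sub>C y) = cnj c * cinner x y"
  by (metis cinner_commute cinner_cscale_left complex_cnj_mult)

lemma subspace_closure:
  fixes S :: "'a::real_normed_vector set"
  assumes "subspace S"
  shows "subspace (closure S)"
proof (rule subspaceI)
  show "0 \<in> closure S"
    using subspace_0[OF assms] closure_subset by blast
next
  fix x y assume "x \<in> closure S" "y \<in> closure S"
  then obtain f g where "\<forall>n. f n \<in> S" "f \<longlonglongrightarrow> x" "\<forall>n. g n \<in> S" "g \<longlonglongrightarrow> y"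
    by (auto simp: closure_sequential)
  then have "\<forall>n. f n + g n \<in> S" "(\<lambda>n. f n + g n) \<longlonglongrightarrow> x + y"
    using subspace_add[OF assms] by (auto intro: tendsto_add)
  then show "x + y \<in> closure S"
    unfolding closure_sequential by (intro exI[of _ "\<lambda>n. f n + g n"] conjI)
next
  fix c x assume "x \<in> closure S"
  then obtain f where "\<forall>n. f n \<in> S" "f \<longlonglongrightarrow> x"
    by (auto simp: closure_sequential)
  then have "\<forall>n. c *\<^sub>R f n \<in> S" "(\<lambda>n. c *\<^sub>R f n) \<longlonglongrightarrow> c *\<^sub>R x"
    using subspace_scale[OF assms] by (auto intro: tendsto_scaleR)
  then show "c *\<^sub>R x \<in> closure S"
    unfolding closure_sequential by (intro exI[of _ "\<lambda>n. c *\<^sub>R f n"] conjI)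
qed

lemma subspace_closed_cspan: "subspace (closed_cspan S)"
proof -
  interpret vector_space "cscale :: complex \<Rightarrow> 'a \<Rightarrow> 'a"
    by (rule vector_space_cscale)
  have "Real_Vector_Spaces.subspace (span S)"
    by (auto simp: Real_Vector_Spaces.subspace_def scaleR_eq_cscale
        intro: span_zero span_add span_scale)
  then show ?thesis
    unfolding closed_cspan_def by (rule subspace_closure)
qed

lemma in_closed_cspan: "x \<in> S \<Longrightarrow> x \<in> closed_cspan S"
proof -
  interpret vector_space "cscale :: complex \<Rightarrow> 'a \<Rightarrow> 'a"
    by (rule vector_space_cscale)
  show "x \<in> S \<Longrightarrow> x \<in> closed_cspan S"
    unfolding closed_cspan_def using closure_subset span_base by blast
qed

context weakly_monotone_fock
begin

abbreviation fock :: "'f set" where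
  "fock \<equiv> weakly_monotone_fock_space tens e"

definition deformed_position :: "real \<Rightarrow> 'f \<Rightarrow> 'f" where
  "deformed_position lam = (\<lambda>x. A 1 x + Ad 1 x + complex_of_real lam *\<^sub>C Ad 1 (A 1 x))"

abbreviation e1_power :: "nat \<Rightarrow> 'f" where
  "e1_power k \<equiv> basis_tensor tens e (replicate k 1)"

lemma monotone_word_replicate: "monotone_word (replicate k 1)"
  by (auto simp: monotone_word_def sorted_wrt_iff_nth_less)

lemma e1_power_0: "e1_power 0 = vacuum tens"
  by (simp add: basis_tensor_def)

lemma e1_power_in_fock: "e1_power k \<in> fock"
proof -
  consider "k = 0" | "k = 1" | "2 \<le> k" by linarith
  then have "e1_power k \<in> {vacuum tens} \<union> range (\<lambda>h. tens [h]) \<union>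
      {basis_tensor tens e w |w. monotone_word w \<and> length w \<ge> 2}"
  proof cases
    case 3
    then show ?thesis
      using monotone_word_replicate[of k] by force
  qed (auto simp: basis_tensor_def)
  then show ?thesis
    unfolding weakly_monotone_fock_space_def by (rule in_closed_cspan)
qed

lemma annihilation_in_fock: "x \<in> fock \<Longrightarrow> A 1 x \<in> fock"
  using bounded_annihilation[of 1] by (auto simp: bounded_operator_on_def)

lemma creation_in_fock: "x \<in> fock \<Longrightarrow> Ad 1 x \<in> fock"
  using bounded_creation[of 1] by (auto simp: bounded_operator_on_def)

text \<open>The only scalar in the operator is the real number \<open>lam\<close>, so being a real subspace suffices.\<close>

lemma deformed_position_in_fock:
  assumes "x \<in> fock"
  shows "deformed_position lam x \<in> fock"
proof -
  have "subspace fock"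
    unfolding weakly_monotone_fock_space_def by (rule subspace_closed_cspan)
  then show ?thesis
    using assms annihilation_in_fock creation_in_fock
    by (simp add: deformed_position_def subspace_add subspace_scale del: One_nat_def
        flip: scaleR_eq_cscale)
qed

lemma deformed_position_symmetric:
  assumes x: "x \<in> fock" and y: "y \<in> fock"
  shows "cinner (deformed_position lam x) y = cinner x (deformed_position lam y)"
proof -
  have adj: "cinner (A 1 u) w = cinner u (Ad 1 w)" if "u \<in> fock" "w \<in> fock" for u w
    using mutually_adjoint[of 1 u w] that by simp
  have adj': "cinner (Ad 1 u) w = cinner u (A 1 w)" if "u \<in> fock" "w \<in> fock" for u w
    using adj[OF that(2,1)] by (metis cinner_commute)
  show ?thesis
    using x y annihilation_in_fock
    by (simp add: cinner_add_left cinner_add_right cinner_cscale_left cinner_cscale_right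
        deformed_position_def adj adj' del: One_nat_def)
qed

lemma creation_e1_power: "Ad 1 (e1_power k) = e1_power (Suc k)"
proof (cases k)
  case 0
  then show ?thesis
    using creation_vacuum[of 1] by (simp add: basis_tensor_def)
next
  case (Suc k')
  then show ?thesis
    using creation_tensor[of 1 1 "replicate k' 1"] monotone_word_replicate[of k] by simp
qed

lemma annihilation_e1_power_Suc: "A 1 (e1_power (Suc k)) = e1_power k"
  using annihilation_tensor[of 1 1 "replicate k 1"] monotone_word_replicate[of "Suc k"] by simp

lemma creation_zero: "Ad 1 0 = 0"
proof -
  have "0 \<in> fock"
    unfolding weakly_monotone_fock_space_def by (rule subspace_0[OF subspace_closed_cspan])
  then have "Ad 1 (0 + 0) = Ad 1 0 + Ad 1 0"
    using bounded_creation[of 1] unfolding bounded_operator_on_def by blast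
  then show ?thesis by simp
qed

lemma deformed_position_vacuum: "deformed_position lam (vacuum tens) = e1_power 1"
proof -
  interpret vector_space "cscale :: complex \<Rightarrow> 'f \<Rightarrow> 'f"
    by (rule vector_space_cscale)
  show ?thesis
    using annihilation_vacuum[of 1] creation_vacuum[of 1]
    by (simp add: deformed_position_def creation_zero del: One_nat_def) simp
qed

lemma deformed_position_e1_power_Suc:
  "deformed_position lam (e1_power (Suc k)) =
     e1_power k + complex_of_real lam *\<^sub>C e1_power (Suc k) + e1_power (Suc (Suc k))"
  unfolding deformed_position_def annihilation_e1_power_Suc creation_e1_power
  by (simp add: algebra_simps)

definition iterate_coeff :: "real \<Rightarrow> nat \<Rightarrow> nat \<Rightarrow> complex" where
  "iterate_coeff lam n k = cinner ((deformed_position lam ^^ n) (vacuum tens)) (e1_power k)"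

lemma vacuum_moment_eq: "vacuum_moment tens A Ad n lam = iterate_coeff lam n 0"
  by (simp add: vacuum_moment_def iterate_coeff_def deformed_position_def basis_tensor_def)

lemma iterate_coeff_start: "iterate_coeff lam 0 (Suc k) = 0"
  using full_fock_space
  by (simp add: iterate_coeff_def full_fock_space_def basis_tensor_def)

lemma iterate_coeff_transfer:
  "iterate_coeff lam (Suc n) k =
     cinner ((deformed_position lam ^^ n) (vacuum tens)) (deformed_position lam (e1_power k))"
proof -
  have "(deformed_position lam ^^ n) (vacuum tens) \<in> fock"
  proof (induction n)
    case 0
    then show ?case
      using e1_power_in_fock[of 0] by (simp add: basis_tensor_def)
  next
    case (Suc n)
    then show ?case
      by (simp add: deformed_position_in_fock)
  qed
  then show ?thesis
    unfolding iterate_coeff_def funpow.simps comp_apply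
    by (intro deformed_position_symmetric e1_power_in_fock)
qed

lemma iterate_coeff_Suc_0: "iterate_coeff lam (Suc n) 0 = iterate_coeff lam n 1"
  unfolding iterate_coeff_transfer e1_power_0 deformed_position_vacuum
  by (simp add: iterate_coeff_def)

lemma iterate_coeff_Suc_Suc:
  "iterate_coeff lam (Suc n) (Suc k) =
     iterate_coeff lam n k + complex_of_real lam * iterate_coeff lam n (Suc k)
     + iterate_coeff lam n (Suc (Suc k))"
  unfolding iterate_coeff_transfer deformed_position_e1_power_Suc
  by (simp add: iterate_coeff_def cinner_add_right cinner_cscale_right)

end

section \<open>The recursion for the moments\<close>

theorem proposition3p2:
  fixes tens :: "'h::complex_hilbert_space list \<Rightarrow> 'f::complex_hilbert_space"
    and e :: "nat \<Rightarrow> 'h"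
    and A Ad :: "nat \<Rightarrow> 'f \<Rightarrow> 'f"
    and n :: nat and lam :: real
  assumes "weakly_monotone_fock tens e A Ad"
    and "n \<ge> 2" and "lam > 0"
  shows "vacuum_moment tens A Ad n lam =
    (\<Sum>k=2..n. vacuum_moment tens A Ad (n - k) lam * complex_of_real (motzkin_poly (k - 2) lam))"
proof -
  interpret weakly_monotone_fock tens e A Ad
    by (fact assms(1))
  let ?b = "\<lambda>n. vacuum_moment tens A Ad n lam"
  let ?M = "\<lambda>m. complex_of_real (motzkin_poly m lam)"
  obtain m where n: "n = Suc m"
    using \<open>n \<ge> 2\<close> by (cases n) auto
  have "?b n = iterate_coeff lam m (Suc 0)"
    by (simp add: n vacuum_moment_eq iterate_coeff_Suc_0)
  also have "\<dots> = (\<Sum>j<m. ?b j * ?M (m - Suc j))"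
    by (subst last_visit_decomposition[of "iterate_coeff lam",
          OF iterate_coeff_start iterate_coeff_Suc_Suc])
      (simp add: vacuum_moment_eq motzkin_poly_eq_prefix_poly)
  \<comment> \<open>\<open>k = n - j\<close> is the length of the last excursion above height \<open>0\<close>.\<close>
  also have "\<dots> = (\<Sum>k=2..n. ?b (n - k) * ?M (k - 2))"
    by (rule sum.reindex_bij_witness[of _ "\<lambda>k. n - k" "\<lambda>j. n - j"]) (auto simp: n)
  finally show ?thesis .
qed

end
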